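(* Let $\mathcal{X}$ be a Euclidean space. If the set-valued operator $A:\mathcal{X}\rightrightarrows\mathcal{X}$ is partly smooth at the point $\bar x$ relative to the set $\mathcal{M}\subset\mathcal{X}$, and the (single-valued) operator $B:\mathcal{X}\to\mathcal{X}$ is smooth on an open set containing $\bar x$, then the set-valued operator $A+B$ is partly smooth at $\bar x$ relative to $\mathcal{M}$.
   Context: Notation. For a convex set $S$, $\operatorname{Lin}(S)=\operatorname{Aff}(S)-x$ ($x\in S$) is the linear subspace parallel to the affine hull of $S$. $T_{\mathcal{M}}(x)$, $N_{\mathcal{M}}(x)$ are the tangent and normal spaces of the manifold $\mathcal{M}$ at $x\in\mathcal{M}$; $P_V$ is the orthogonal projection onto $V$. Semicontinuity. A set-valued operator $A$ is lower semi-continuous at $\bar x$ if for every $\bar u\in A(\bar x)$ and every sequence $x^{(k)}\in\operatorname{dom}A$ with $x^{(k)}\to\bar x$ there are $u^{(k)}\in A(x^{(k)})$ with $u^{(k)}\to\bar u$. $A$ is upper semi-continuous at $\bar x$ if $x^{(k)}\to\bar x$, $u^{(k)}\in A(x^{(k)})$, $u^{(k)}\to\bar u$ imply $\bar u\in A(\bar x)$. $A$ is upper semi-continuous if it is so at every point of its domain. Continuous along $\mathcal{M}$ means both lower and upper semi-continuous with sequences restricted to $\mathcal{M}$. Partly smooth operator. A set-valued operator $A$ on a Euclidean space is partly smooth at $\bar x$ relative to a set $\mathcal{M}\ni\bar x$ if $\mathcal{M}$ is a $C^p$-manifold ($p\ge1$) around $\bar x$, $A$ is upper semi-continuous, and: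 (Regularity) for every $x$ close to $\bar x$, $A(x)$ is nonempty, closed and convex; (Sharpness) $N_{\mathcal{M}}(\bar x)=\operatorname{Lin}(A(\bar x))$, and $x\mapsto P_{T_{\mathcal{M}}(x)}(A(x))$ is single-valued and continuous around $\bar x$ along $\mathcal{M}$; (Continuity) $A$ is continuous along $\mathcal{M}$ near $\bar x$.
   Formalization: As upper semi-continuity is required at every point of the domain, the claim fails if B is discontinuous away from x̄; it is proved for B with its domain restricted to the open set where it is smooth, and for B on all of X if B is also continuous on dom A. *)

theory Defs
  imports "HOL-Analysis.Analysis" "HOL-Library.Extended_Nat"
begin

text \<open>Meant for open \<open>S\<close> only, as it uses two-sided derivatives.\<close>

primrec higher_differentiable_on ::
    "nat \<Rightarrow> 'a::euclidean_space set \<Rightarrow> ('a \<Rightarrow> 'b::euclidean_space) \<Rightarrow> bool" where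
  "higher_differentiable_on 0 S f \<longleftrightarrow> continuous_on S f"
| "higher_differentiable_on (Suc n) S f \<longleftrightarrow>
     (\<forall>x\<in>S. f differentiable (at x)) \<and>
     (\<forall>v. higher_differentiable_on n S (\<lambda>x. frechet_derivative f (at x) v))"

definition C_on :: "enat \<Rightarrow> 'a::euclidean_space set \<Rightarrow> ('a \<Rightarrow> 'b::euclidean_space) \<Rightarrow> bool" where
  "C_on k S f \<longleftrightarrow> (\<forall>n. enat n \<le> k \<longrightarrow> higher_differentiable_on n S f)"

text \<open>
  Near \<open>xbar\<close> the set \<open>M\<close> is the zero set of a \<open>C\<^sup>p\<close> submersion. The target space of the
  submersion (of dimension the codimension of \<open>M\<close>, which is not fixed) is
  represented by a linear subspace \<open>W\<close> of the ambient space.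
\<close>

definition manifold_around :: "enat \<Rightarrow> 'a::euclidean_space set \<Rightarrow> 'a \<Rightarrow> bool" where
  "manifold_around p M xbar \<longleftrightarrow> 1 \<le> p \<and> xbar \<in> M \<and>
     (\<exists>U W (\<Phi> :: 'a \<Rightarrow> 'a). open U \<and> xbar \<in> U \<and> subspace W \<and> C_on p U \<Phi> \<and> \<Phi> ` U \<subseteq> W \<and>
        (\<forall>x\<in>U. range (frechet_derivative \<Phi> (at x)) = W) \<and>
        M \<inter> U = {x \<in> U. \<Phi> x = 0})"

text \<open>Velocities at \<open>x\<close> of curves in \<open>M\<close> through \<open>x\<close>.\<close>

definition tangent_space :: "'a::euclidean_space set \<Rightarrow> 'a \<Rightarrow> 'a set" where
  "tangent_space M x = {v. \<exists>\<gamma> \<epsilon>. \<epsilon> > 0 \<and> \<gamma> (0::real) = x \<and> (\<forall>t. \<bar>t\<bar> < \<epsilon> \<longrightarrow> \<gamma> t \<in> M) \<and>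
     (\<gamma> has_vector_derivative v) (at 0)}"

definition normal_space :: "'a::euclidean_space set \<Rightarrow> 'a \<Rightarrow> 'a set" where
  "normal_space M x = orthogonal_comp (tangent_space M x)"

text \<open>The translate of the affine hull does not depend on the base point \<open>x\<close> in \<open>S\<close>, so the
  comprehension over all base points is that common translate (and is empty for empty \<open>S\<close>).\<close>

definition Lin :: "'a::euclidean_space set \<Rightarrow> 'a set" where
  "Lin S = {y - x |x y. x \<in> S \<and> y \<in> affine hull S}"

definition orth_proj :: "'a::euclidean_space set \<Rightarrow> 'a \<Rightarrow> 'a" where
  "orth_proj V x = (THE y. y \<in> V \<and> x - y \<in> orthogonal_comp V)"

definition op_dom :: "('a \<Rightarrow> 'b set) \<Rightarrow> 'a set" where
  "op_dom A = {x. A x \<noteq> {}}"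

text \<open>The set \<open>S\<close> restricts the sequences approaching the point; \<open>S = UNIV\<close> gives the
  unrestricted notions.\<close>

definition lsc_along_at ::
    "'a::topological_space set \<Rightarrow> ('a \<Rightarrow> 'b::topological_space set) \<Rightarrow> 'a \<Rightarrow> bool" where
  "lsc_along_at S A xbar \<longleftrightarrow>
     (\<forall>ubar \<in> A xbar. \<forall>X. (\<forall>k. X k \<in> op_dom A \<inter> S) \<and> X \<longlonglongrightarrow> xbar \<longrightarrow>
        (\<exists>u. (\<forall>k. u k \<in> A (X k)) \<and> u \<longlonglongrightarrow> ubar))"

definition usc_along_at ::
    "'a::topological_space set \<Rightarrow> ('a \<Rightarrow> 'b::topological_space set) \<Rightarrow> 'a \<Rightarrow> bool" where
  "usc_along_at S A xbar \<longleftrightarrow>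
     (\<forall>X u ubar. (\<forall>k. X k \<in> S) \<and> X \<longlonglongrightarrow> xbar \<and> (\<forall>k. u k \<in> A (X k)) \<and> u \<longlonglongrightarrow> ubar
        \<longrightarrow> ubar \<in> A xbar)"

definition usc :: "('a::topological_space \<Rightarrow> 'b::topological_space set) \<Rightarrow> bool" where
  "usc A \<longleftrightarrow> (\<forall>x \<in> op_dom A. usc_along_at UNIV A x)"

definition partly_smooth ::
    "enat \<Rightarrow> ('a::euclidean_space \<Rightarrow> 'a set) \<Rightarrow> 'a \<Rightarrow> 'a set \<Rightarrow> bool" where
  "partly_smooth p A xbar M \<longleftrightarrow>
     manifold_around p M xbar \<and> usc A \<and>
     (\<forall>\<^sub>F x in nhds xbar. A x \<noteq> {} \<and> closed (A x) \<and> convex (A x)) \<and>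
     normal_space M xbar = Lin (A xbar) \<and>
     (\<exists>U f. open U \<and> xbar \<in> U \<and> continuous_on (M \<inter> U) f \<and>
        (\<forall>x \<in> M \<inter> U. orth_proj (tangent_space M x) ` A x = {f x})) \<and>
     (\<exists>U. open U \<and> xbar \<in> U \<and>
        (\<forall>x \<in> M \<inter> U. lsc_along_at M A x \<and> usc_along_at M A x))"

text \<open>A single-valued operator with domain \<open>D\<close>, viewed as a set-valued operator. Since
  \<open>usc\<close> is required globally, adding a map defined everywhere but discontinuous away from the
  point of interest can destroy partial smoothness; giving the map a smaller domain \<open>D\<close>, on
  which it is continuous, avoids this.\<close>

definition single_valued_op :: "'a set \<Rightarrow> ('a \<Rightarrow> 'b) \<Rightarrow> 'a \<Rightarrow> 'b set" where
  "single_valued_op D B x = (if x \<in> D then {B x} else {})"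

text \<open>Pointwise Minkowski sum; its domain is the intersection of the two domains.\<close>

definition op_sum :: "('a \<Rightarrow> 'b::plus set) \<Rightarrow> ('a \<Rightarrow> 'b set) \<Rightarrow> 'a \<Rightarrow> 'b set" where
  "op_sum A A' x = A x + A' x"

end

theory Submission
  imports Defs
begin

text \<open>
  Adding \<open>B\<close> translates \<open>A x\<close> by \<open>B x\<close>, which changes neither \<open>Lin (A x)\<close> nor closedness and
  convexity, and preserves semicontinuity where \<open>B\<close> is continuous. The projection of the sum
  onto the tangent space of \<open>M\<close> at \<open>x\<close> is that of \<open>A x\<close> translated by the projection of \<open>B x\<close>, so
  the real content is that the tangent spaces of a \<open>C\<^sup>1\<close> manifold are subspaces depending
  continuously on the point. If \<open>M\<close> is locally the zero set of \<open>\<Phi>\<close> whose derivatives \<open>L x\<close> have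
  constant range \<open>W\<close>, then the tangent space is \<open>ker (L x)\<close> by the inverse function theorem. Writing
  \<open>L\<^sup>*\<close> for the adjoint and \<open>P\<close> for orthogonal projection, \<open>P\<close> onto \<open>ker (L x)\<close> maps \<open>b\<close> to
  \<open>b - (L x)\<^sup>* w\<close>, where \<open>w\<close> solves \<open>(L x (L x)\<^sup>* + I - P\<^sub>W) w = L x b\<close>, an invertible
  linear system with coefficients continuous in \<open>x\<close>.
\<close>

section \<open>Orthogonal projections and adjoints\<close>

lemma orth_proj_eqI:
  assumes "subspace V" "y \<in> V" "x - y \<in> orthogonal_comp V"
  shows "orth_proj V x = y"
  unfolding orth_proj_def
proof (rule the_equality)
  fix z assume z: "z \<in> V \<and> x - z \<in> orthogonal_comp V"
  \<comment> \<open>Two candidates differ by \<open>z - y\<close>, which lies both in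
    \<open>V\<close> and in its complement and is therefore orthogonal to itself.\<close>
  then have "(x - y) - (x - z) \<in> orthogonal_comp V"
    using assms(3) subspace_diff[OF subspace_orthogonal_comp] by blast
  moreover have "z - y \<in> V"
    using assms z by (intro subspace_diff) auto
  ultimately have "(z - y) \<bullet> (z - y) = 0"
    by (simp add: orthogonal_comp_def orthogonal_def)
  then show "z = y" by simp
qed (use assms in auto)

lemma
  assumes "subspace V"
  shows orth_proj_mem: "orth_proj V x \<in> V"
    and orth_proj_diff_mem: "x - orth_proj V x \<in> orthogonal_comp V"
proof -
  obtain y z where yz: "y \<in> span V" "\<And>w. w \<in> span V \<Longrightarrow> orthogonal z w" "x = y + z"
    using orthogonal_subspace_decomp_exists[of V x] by metis
  moreover have "span V = V" using assms by simp
  ultimately have "y \<in> V" "x - y \<in> orthogonal_comp V"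
    by (auto simp: orthogonal_comp_def orthogonal_commute)
  with orth_proj_eqI[OF assms] show "orth_proj V x \<in> V" "x - orth_proj V x \<in> orthogonal_comp V"
    by auto
qed

lemma orth_proj_add:
  assumes "subspace V"
  shows "orth_proj V (x + y) = orth_proj V x + orth_proj V y"
proof (rule orth_proj_eqI[OF assms])
  have "x + y - (orth_proj V x + orth_proj V y) = (x - orth_proj V x) + (y - orth_proj V y)"
    by simp
  then show "x + y - (orth_proj V x + orth_proj V y) \<in> orthogonal_comp V"
    by (metis assms orth_proj_diff_mem subspace_add subspace_orthogonal_comp)
qed (simp add: assms orth_proj_mem subspace_add)

lemma linear_orth_proj:
  assumes "subspace V"
  shows "linear (orth_proj V)"
proof (rule linearI)
  show "orth_proj V (c *\<^sub>R x) = c *\<^sub>R orth_proj V x" for c x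
    by (rule orth_proj_eqI[OF assms])
      (auto simp: assms orth_proj_mem subspace_scale orth_proj_diff_mem subspace_orthogonal_comp
        simp flip: scaleR_diff_right)
qed (simp add: assms orth_proj_add)

text \<open>The residual is orthogonal to the projection. This supplies one of the two squares that
  make the derivative of the auxiliary map \<open>G\<close> below positive definite.\<close>

lemma inner_orth_proj_self:
  assumes "subspace V"
  shows "orth_proj V x \<bullet> x = (norm (orth_proj V x))\<^sup>2"
proof -
  have "orth_proj V x \<bullet> (x - orth_proj V x) = 0"
    using orth_proj_mem[OF assms, of x] orth_proj_diff_mem[OF assms, of x]
    by (auto simp: orthogonal_comp_def orthogonal_def)
  then show ?thesis by (simp add: inner_diff_right power2_norm_eq_inner)
qed

lemma orth_proj_of_mem: "subspace V \<Longrightarrow> x \<in> V \<Longrightarrow> orth_proj V x = x"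
  by (rule orth_proj_eqI) (auto simp: orthogonal_comp_def orthogonal_def)

text \<open>Displays the adjoint as a finite sum in the values \<open>f i\<close>, so that
  continuity in a parameter passes from the values of a linear map to its adjoint.\<close>

lemma adjoint_eq_sum:
  fixes f :: "'a::euclidean_space \<Rightarrow> 'b::euclidean_space"
  assumes "linear f"
  shows "adjoint f w = (\<Sum>i\<in>Basis. (w \<bullet> f i) *\<^sub>R i)"
  by (rule euclidean_eqI) (simp add: adjoint_clauses[OF assms])

text \<open>Pairing with \<open>w\<close> turns \<open>f (adjoint f w) = 0\<close> into a vanishing
  norm of \<open>adjoint f w\<close>; so \<open>w\<close> is orthogonal to \<open>range f\<close>,
  in which it lies.\<close>

lemma adjoint_eq_0_on_range:
  fixes f :: "'a::euclidean_space \<Rightarrow> 'b::euclidean_space"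
  assumes "linear f" "w \<in> range f" "f (adjoint f w) = 0"
  shows "w = 0"
proof -
  have "adjoint f w \<bullet> adjoint f w = 0"
    by (simp add: adjoint_clauses[OF assms(1)] assms(3))
  then have "adjoint f w = 0" by simp
  then have "w \<bullet> f x = 0" for x
    using adjoint_clauses(2)[OF assms(1), of w x] by simp
  then show ?thesis
    using assms(2) by (metis imageE inner_eq_zero_iff)
qed

section \<open>Tangent spaces of level sets\<close>

lemma tangent_space_level_set:
  fixes \<Phi> :: "'a::euclidean_space \<Rightarrow> 'b::euclidean_space"
  assumes "open U"
    and deriv: "\<And>y. y \<in> U \<Longrightarrow> (\<Phi> has_derivative L y) (at y)"
    and cont: "\<And>v. continuous_on U (\<lambda>y. L y v)"
    and M: "M \<inter> U = {y \<in> U. \<Phi> y = 0}"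
    and x: "x \<in> M \<inter> U"
    and range: "\<Phi> ` U \<subseteq> range (L x)"
  shows "tangent_space M x = {v. L x v = 0}"
proof -
  have xU: "x \<in> U" and "\<Phi> x = 0" using x M by auto
  have lin: "linear (L y)" if "y \<in> U" for y using deriv[OF that] by (rule has_derivative_linear)
  show ?thesis
  proof (intro set_eqI iffI)
    fix v assume "v \<in> tangent_space M x"
    then obtain \<gamma> \<epsilon> where \<gamma>: "\<epsilon> > 0" "\<gamma> (0::real) = x" "\<And>t. \<bar>t\<bar> < \<epsilon> \<Longrightarrow> \<gamma> t \<in> M"
      "(\<gamma> has_vector_derivative v) (at 0)" unfolding tangent_space_def by auto
    have "isCont \<gamma> 0" using \<gamma>(4) by (rule has_vector_derivative_continuous)
    then have "\<forall>\<^sub>F t in nhds 0. \<gamma> t \<in> U"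
      using \<open>open U\<close> xU \<gamma>(2) unfolding continuous_at_open eventually_nhds by metis
    moreover have "\<forall>\<^sub>F t in nhds 0. \<gamma> t \<in> M"
      unfolding eventually_nhds_metric using \<gamma>(1,3) by (auto simp: dist_real_def)
    ultimately have ev: "\<forall>\<^sub>F t in nhds 0. \<Phi> (\<gamma> t) = 0"
      by eventually_elim (use M in auto)
    \<comment> \<open>The derivative at 0 is computed twice: by the chain rule, and as that of a
      function vanishing near 0.\<close>
    have "((\<Phi> \<circ> \<gamma>) has_derivative L x \<circ> (\<lambda>t. t *\<^sub>R v)) (at 0)"
      using \<gamma> deriv[OF xU] unfolding has_vector_derivative_def by (intro diff_chain_at) auto
    moreover have "((\<Phi> \<circ> \<gamma>) has_derivative (\<lambda>_. 0)) (at 0)"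
      by (rule has_derivative_transform_eventually[OF has_derivative_const[of 0]])
        (use ev eventually_nhds_x_imp_x[OF ev] in
          \<open>auto simp: eventually_at_filter elim: eventually_mono\<close>)
    ultimately have "L x \<circ> (\<lambda>t. t *\<^sub>R v) = (\<lambda>_. 0)" by (rule has_derivative_unique)
    from fun_cong[OF this, of 1] show "v \<in> {v. L x v = 0}" by simp
  next
    fix v assume "v \<in> {v. L x v = 0}"
    define K where "K = {v. L x v = 0}"
    then have "v \<in> K" using \<open>v \<in> {v. L x v = 0}\<close> by simp
    have K: "subspace K" unfolding K_def using lin[OF xU] by (rule linear_subspace_kernel)
    define La where "La = adjoint (L x)"
    have linLa: "linear La" unfolding La_def using lin[OF xU] by (rule adjoint_linear)
    have blLa: "bounded_linear La" using linLa linear_conv_bounded_linear by blast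
    have blP: "bounded_linear (orth_proj K)"
      using linear_orth_proj[OF K] linear_conv_bounded_linear by blast
    \<comment> \<open>\<open>La\<close> maps into the complement of \<open>K\<close> and is injective on \<open>range (L x)\<close>, so \<open>G y \<in> K\<close>
      forces \<open>\<Phi> y = 0\<close>; the derivative of \<open>G\<close> at \<open>x\<close> is positive definite and fixes \<open>K\<close>.
      Hence the local inverse of \<open>G\<close> maps the line spanned by \<open>v\<close> to a curve in \<open>M\<close> with velocity \<open>v\<close>.\<close>
    define G where "G y = La (\<Phi> y) + orth_proj K (y - x)" for y
    define S where "S y h = La (L y h) + orth_proj K h" for y h
    have blS: "bounded_linear (S y)" if "y \<in> U" for y
      unfolding S_def using deriv[OF that] blLa blP
      by (intro bounded_linear_add) (auto intro: bounded_linear_compose has_derivative_bounded_linear)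
    have apS: "blinfun_apply (Blinfun (S y)) = S y" if "y \<in> U" for y
      using blS[OF that] by (rule bounded_linear_Blinfun_apply)
    have derG: "(G has_derivative blinfun_apply (Blinfun (S y))) (at y)" if "y \<in> U" for y
    proof -
      have "((\<lambda>y. orth_proj K (y - x)) has_derivative orth_proj K) (at y)"
        by (rule bounded_linear.has_derivative[OF blP, THEN has_derivative_eq_rhs])
          (auto intro!: derivative_eq_intros)
      then show ?thesis
        unfolding apS[OF that] G_def S_def
        by (intro has_derivative_add bounded_linear.has_derivative[OF blLa] deriv[OF that]) 
    qed
    have contS: "continuous_on U (\<lambda>y. Blinfun (S y))"
    proof (rule continuous_on_blinfun_componentwise)
      fix i :: 'a
      have "continuous_on U (\<lambda>y. S y i)"
        unfolding S_def
        by (intro continuous_intros bounded_linear.continuous_on[OF blLa] cont)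
      then show "continuous_on U (\<lambda>y. blinfun_apply (Blinfun (S y)) i)"
        by (simp add: apS cong: continuous_on_cong)
    qed
    have "h = 0" if "S x h = 0" for h
    proof -
      have "(norm (L x h))\<^sup>2 + (norm (orth_proj K h))\<^sup>2 = S x h \<bullet> h"
        by (simp add: S_def La_def adjoint_clauses[OF lin[OF xU]] inner_add_left
            inner_orth_proj_self[OF K] power2_norm_eq_inner)
      then have "L x h = 0" "orth_proj K h = 0"
        using that by (simp_all add: add_nonneg_eq_0_iff)
      \<comment> \<open>\<open>L x h = 0\<close> puts \<open>h\<close> into \<open>K\<close>, where
        the projection is the identity, while that projection of \<open>h\<close> is 0.\<close>
      then show ?thesis using orth_proj_of_mem[OF K, of h] by (simp add: K_def)
    qed
    then have injS: "inj (S x)"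
      using blS[OF xU] by (simp add: linear_injective_0 bounded_linear.linear)
    then obtain R where R: "linear R" "R \<circ> S x = id"
      using linear_injective_left_inverse blS[OF xU] bounded_linear.linear by metis
    have inv: "Blinfun R o\<^sub>L Blinfun (S x) = id_blinfun"
    proof (rule blinfun_eqI)
      fix h
      show "blinfun_apply (Blinfun R o\<^sub>L Blinfun (S x)) h = blinfun_apply id_blinfun h"
        using R(1) fun_cong[OF R(2), of h]
        by (simp add: apS[OF xU] bounded_linear_Blinfun_apply linear_conv_bounded_linear)
    qed
    obtain U' V g g' where g: "open U'" "U' \<subseteq> U" "x \<in> U'" "open V" "G x \<in> V"
      "homeomorphism U' V G g" "\<And>y. y \<in> V \<Longrightarrow> (g has_derivative (g' y)) (at y)"
      "\<And>y. y \<in> V \<Longrightarrow> g' y = inv (blinfun_apply (Blinfun (S (g y))))"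
      "\<And>y. y \<in> V \<Longrightarrow> bij (blinfun_apply (Blinfun (S (g y))))"
      using inverse_function_theorem[OF \<open>open U\<close> derG contS xU inv] by metis
    have G0: "G x = 0"
      by (simp add: G_def \<open>\<Phi> x = 0\<close> linear_0 linLa linear_orth_proj[OF K])
    have g0: "g 0 = x" using g(3,6) G0 by (metis homeomorphism_apply1)
    \<comment> \<open>\<open>L x v = 0\<close> kills the first summand of \<open>S x v\<close>. As
      \<open>g' 0\<close> inverts \<open>S x\<close>, it fixes the line through \<open>v\<close>
      too, which gives the curve the velocity \<open>v\<close>.\<close>
    have "S x v = v"
      using \<open>v \<in> K\<close> orth_proj_of_mem[OF K] by (simp add: S_def K_def linear_0 linLa)
    then have g'v: "g' 0 (t *\<^sub>R v) = t *\<^sub>R v" for t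
      using g(5) G0 injS blS[OF xU]
      by (metis apS[OF xU] g0 g(8) inv_f_f linear_simps(5))
    obtain e where e: "e > 0" "ball 0 e \<subseteq> V" using g(4,5) G0 by (metis open_contains_ball)
    \<comment> \<open>The \<open>+ 1\<close> in the denominator covers the case
      \<open>v = 0\<close>.\<close>
    have inV: "t *\<^sub>R v \<in> V" if "\<bar>t\<bar> < e / (norm v + 1)" for t
    proof -
      have "\<bar>t\<bar> * norm v \<le> \<bar>t\<bar> * (norm v + 1)" by (simp add: mult_left_mono)
      also have "\<dots> < e" using that by (simp add: pos_less_divide_eq add_nonneg_pos)
      finally show ?thesis using e(2) by auto
    qed
    show "v \<in> tangent_space M x"
      unfolding tangent_space_def
    proof (intro CollectI exI conjI allI impI)
      show "e / (norm v + 1) > 0" using e by (simp add: add_nonneg_pos)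
      show "g (0 *\<^sub>R v) = x" using g0 by simp
      show "g (t *\<^sub>R v) \<in> M" if "\<bar>t\<bar> < e / (norm v + 1)" for t
      proof -
        let ?y = "g (t *\<^sub>R v)"
        have yU: "?y \<in> U" and "G ?y = t *\<^sub>R v"
          using inV[OF that] g(2,6) by (auto simp: homeomorphism_def)
        then have "La (\<Phi> ?y) = t *\<^sub>R v - orth_proj K (?y - x)"
          by (simp add: G_def algebra_simps)
        also have "\<dots> \<in> K"
          using K \<open>v \<in> K\<close> by (simp add: subspace_diff subspace_scale orth_proj_mem)
        finally have "L x (La (\<Phi> ?y)) = 0" by (simp add: K_def)
        \<comment> \<open>Here \<open>range\<close> stands in for surjectivity of \<open>L x\<close>
          onto the whole codomain: it places \<open>\<Phi> ?y\<close> where \<open>La\<close> is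
          injective.\<close>
        then have "\<Phi> ?y = 0"
          using adjoint_eq_0_on_range[OF lin[OF xU]] range yU unfolding La_def by blast
        then show ?thesis using M yU by auto
      qed
      have "(g has_derivative g' 0) (at (0 *\<^sub>R v))" using g(5,7) G0 by simp
      then have "(g \<circ> (\<lambda>t. t *\<^sub>R v) has_derivative g' 0 \<circ> (\<lambda>t. t *\<^sub>R v)) (at 0)"
        by (intro diff_chain_at) (auto intro!: derivative_eq_intros)
      then show "((\<lambda>t. g (t *\<^sub>R v)) has_vector_derivative v) (at 0)"
        by (simp add: has_vector_derivative_def o_def g'v)
    qed
  qed
qed

section \<open>Continuity of projections onto kernels\<close>

lemma tendsto_solution_linear:
  fixes N :: "'c \<Rightarrow> 'a::euclidean_space \<Rightarrow>\<^sub>L 'b::euclidean_space"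
  assumes N: "(N \<longlongrightarrow> N0) F" and c: "(c \<longlongrightarrow> N0 w0) F"
    and inj: "inj (blinfun_apply N0)"
    and w: "\<forall>\<^sub>F y in F. N y (w y) = c y"
  shows "(w \<longlongrightarrow> w0) F"
proof -
  obtain B where B: "B > 0" "\<And>h. B * norm h \<le> norm (N0 h)"
    using linear_inj_bounded_below_pos[OF _ inj] blinfun.bounded_linear_right bounded_linear.linear
    by metis
  have dist: "((\<lambda>y. dist (N y) N0) \<longlongrightarrow> 0) F"
    using N by (simp flip: tendsto_dist_iff)
  have "\<forall>\<^sub>F y in F. dist (N y) N0 < B / 2"
    by (rule order_tendstoD(2)[OF dist]) (use B(1) in simp)
  then have "\<forall>\<^sub>F y in F. norm (w y - w0) \<le>
      2 / B * (norm (N y - N0) * norm w0 + norm (c y - N0 w0))"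
    using w
  proof eventually_elim
    case (elim y)
    have "B * norm (w y - w0) \<le> norm (N0 (w y - w0))" by (rule B)
    \<comment> \<open>Write \<open>N0\<close> as \<open>N y - (N y - N0)\<close> and substitute
      \<open>N y (w y) = c y\<close>. Since \<open>N y\<close> is within \<open>B / 2\<close> of
      \<open>N0\<close>, the last term is at most half of the lower bound
      \<open>B * norm (w y - w0)\<close> and gets absorbed.\<close>
    also have "N0 (w y - w0) = (c y - N0 w0) - (N y - N0) w0 - (N y - N0) (w y - w0)"
      by (simp add: blinfun.bilinear_simps elim(2)[symmetric])
    also have "norm \<dots> \<le> norm (c y - N0 w0) + norm ((N y - N0) w0) + norm ((N y - N0) (w y - w0))"
      by (meson add_mono norm_triangle_ineq4 order_refl order_trans)
    also have "\<dots> \<le> norm (c y - N0 w0) + norm (N y - N0) * norm w0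
        + norm (N y - N0) * norm (w y - w0)"
      by (intro add_mono norm_blinfun order_refl)
    also have "norm (N y - N0) * norm (w y - w0) \<le> B / 2 * norm (w y - w0)"
      by (rule mult_right_mono) (use elim in \<open>simp_all add: dist_norm\<close>)
    finally have "B / 2 * norm (w y - w0) \<le> norm (N y - N0) * norm w0 + norm (c y - N0 w0)"
      by simp
    then show ?case using B(1) by (simp add: field_simps)
  qed
  moreover have "((\<lambda>y. 2 / B * (norm (N y - N0) * norm w0 + norm (c y - N0 w0))) \<longlongrightarrow> 0) F"
    using N c B(1) by (auto intro!: tendsto_eq_intros simp: tendsto_norm_zero_iff LIM_zero_iff)
  ultimately have "((\<lambda>y. w y - w0) \<longlongrightarrow> 0) F"
    by (rule Lim_null_comparison)
  then show ?thesis by (simp add: LIM_zero_iff)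
qed

text \<open>The common range \<open>W\<close> fixes the rank: where the rank of \<open>L y\<close>
  drops, the kernel could jump. It also makes \<open>orth_proj W\<close> a constant coefficient of
  the linear system.\<close>

lemma continuous_on_orth_proj_kernel:
  fixes L :: "'c::t2_space \<Rightarrow> 'a::euclidean_space \<Rightarrow> 'b::euclidean_space"
  assumes lin: "\<And>y. y \<in> S \<Longrightarrow> linear (L y)"
    and cont: "\<And>v. continuous_on S (\<lambda>y. L y v)"
    and range: "\<And>y. y \<in> S \<Longrightarrow> range (L y) = W"
    and b: "continuous_on S b"
  shows "continuous_on S (\<lambda>y. orth_proj {v. L y v = 0} (b y))"
\<comment> \<open>\<open>W\<close> is known to be a subspace only if some \<open>L y\<close> has it
  as range.\<close>
proof (cases "S = {}")
  case False
  then have W: "subspace W"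
    using lin range by (metis ex_in_conv linear_subspace_image subspace_UNIV)
  \<comment> \<open>The summand \<open>w - orth_proj W w\<close> makes \<open>N y\<close> injective without affecting solutions for
    right-hand sides in \<open>W\<close>.\<close>
  define N where "N y w = L y (adjoint (L y) w) + (w - orth_proj W w)" for y w
  have linN: "linear (N y)" if "y \<in> S" for y
    unfolding N_def
    by (intro linear_compose_add linear_compose_sub linear_ident linear_orth_proj[OF W]
        linear_compose[OF adjoint_linear[OF lin[OF that]] lin[OF that], unfolded o_def])
  then have apN: "blinfun_apply (Blinfun (N y)) = N y" if "y \<in> S" for y
    using that by (simp add: bounded_linear_Blinfun_apply linear_conv_bounded_linear)
  have injN: "inj (N y)" if "y \<in> S" for y
  proof -
    have "w = 0" if "N y w = 0" for w
    proof -
      have W': "L y (adjoint (L y) w) \<in> W" using range[OF \<open>y \<in> S\<close>] by blast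
      \<comment> \<open>Solving \<open>N y w = 0\<close> for \<open>w\<close> gives a difference of
        two elements of \<open>W\<close>. So \<open>w\<close> lies in \<open>W\<close>, the added
        summand vanishes, and only the adjoint term is left.\<close>
      have "orth_proj W w - L y (adjoint (L y) w) = w"
        using that by (simp add: N_def algebra_simps)
      then have "w \<in> W"
        using W W' by (metis orth_proj_mem subspace_diff)
      then have "L y (adjoint (L y) w) = 0" using that by (simp add: N_def orth_proj_of_mem[OF W])
      then show ?thesis
        using \<open>w \<in> W\<close> \<open>y \<in> S\<close> adjoint_eq_0_on_range lin range by blast
    qed
    then show ?thesis using linN[OF that] by (simp add: linear_injective_0)
  qed
  define w where "w y = inv (N y) (L y (b y))" for y
  have w: "N y (w y) = L y (b y)" if "y \<in> S" for y
    unfolding w_def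
    by (simp add: linear_injective_imp_surjective linN injN that surj_f_inv_f)
  \<comment> \<open>\<open>cont\<close> keeps the argument of \<open>L y\<close> fixed; expanding in
    the basis allows arguments \<open>h y\<close> that move with \<open>y\<close>.\<close>
  have Lsum: "L y h = (\<Sum>i\<in>Basis. (h \<bullet> i) *\<^sub>R L y i)" if "y \<in> S" for y h
    using lin[OF that]
    by (metis (no_types, lifting) euclidean_representation linear_scale linear_sum sum.cong)
  have contL: "continuous_on S (\<lambda>y. L y (h y))" if "continuous_on S h" for h
    by (subst continuous_on_cong[OF refl Lsum]) (auto intro!: continuous_intros cont that)
  have contLa: "continuous_on S (\<lambda>y. adjoint (L y) (h y))" if "continuous_on S h" for h
    by (subst continuous_on_cong[OF refl adjoint_eq_sum])
      (auto intro!: continuous_intros cont that lin)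
  have contN: "continuous_on S (\<lambda>y. Blinfun (N y))"
  proof (rule continuous_on_blinfun_componentwise)
    fix i :: 'b
    have "continuous_on S (\<lambda>y. N y i)"
      unfolding N_def by (intro continuous_intros contL contLa)
    then show "continuous_on S (\<lambda>y. blinfun_apply (Blinfun (N y)) i)"
      by (simp add: apN cong: continuous_on_cong)
  qed
  have "continuous_on S w"
    unfolding continuous_on_def
  proof
    fix y assume y: "y \<in> S"
    show "(w \<longlongrightarrow> w y) (at y within S)"
    proof (rule tendsto_solution_linear)
      show "((\<lambda>y. Blinfun (N y)) \<longlongrightarrow> Blinfun (N y)) (at y within S)"
        using contN y by (simp add: continuous_on_def)
      show "((\<lambda>y. L y (b y)) \<longlongrightarrow> blinfun_apply (Blinfun (N y)) (w y)) (at y within S)"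
        using contL[OF b] y by (simp add: continuous_on_def apN w)
      show "inj (blinfun_apply (Blinfun (N y)))" using apN injN y by simp
      show "\<forall>\<^sub>F y in at y within S. blinfun_apply (Blinfun (N y)) (w y) = L y (b y)"
        unfolding eventually_at_filter by (simp add: apN w)
    qed
  qed
  then have "continuous_on S (\<lambda>y. b y - adjoint (L y) (w y))"
    by (intro continuous_intros b contLa)
  moreover have "orth_proj {v. L y v = 0} (b y) = b y - adjoint (L y) (w y)" if y: "y \<in> S" for y
  proof (rule orth_proj_eqI)
    show "subspace {v. L y v = 0}" using lin[OF y] by (rule linear_subspace_kernel)
    \<comment> \<open>The residual lies in \<open>W\<close>, being a difference of values of
      \<open>L y\<close>, yet it projects to 0. Hence it is 0 and the system reduces to
      \<open>L y (adjoint (L y) (w y)) = L y (b y)\<close>.\<close>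
    have "w y - orth_proj W (w y) = L y (b y) - L y (adjoint (L y) (w y))"
      using w[OF y] by (simp add: N_def algebra_simps)
    also have "\<dots> \<in> W" using W range[OF y] by (intro subspace_diff) auto
    finally have "orth_proj W (w y - orth_proj W (w y)) = w y - orth_proj W (w y)"
      by (rule orth_proj_of_mem[OF W])
    moreover have "orth_proj W (w y - orth_proj W (w y)) = 0"
      by (simp add: linear_diff linear_orth_proj W orth_proj_of_mem orth_proj_mem)
    ultimately have "L y (adjoint (L y) (w y)) = L y (b y)"
      using w[OF y] by (simp add: N_def)
    then show "b y - adjoint (L y) (w y) \<in> {v. L y v = 0}"
      using lin[OF y] by (simp add: linear_diff)
    show "b y - (b y - adjoint (L y) (w y)) \<in> orthogonal_comp {v. L y v = 0}"
      using lin[OF y] by (simp add: orthogonal_comp_def orthogonal_def adjoint_clauses)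
  qed
  ultimately show ?thesis by (simp cong: continuous_on_cong)
qed simp


text \<open>\<open>1 \<le> p\<close> makes the defining map continuously differentiable, so the
  tangent spaces are the kernels of its derivatives. \<open>S\<close> stays inside \<open>M\<close>,
  where this identification holds.\<close>

lemma manifold_around_tangent_space:
  fixes M :: "'a::euclidean_space set"
  assumes "manifold_around p M xbar"
  obtains U where "open U" "xbar \<in> U"
    "\<And>x. x \<in> M \<inter> U \<Longrightarrow> subspace (tangent_space M x)"
    "\<And>S b. S \<subseteq> M \<inter> U \<Longrightarrow> continuous_on S b \<Longrightarrow>
       continuous_on S (\<lambda>x. orth_proj (tangent_space M x) (b x))"
proof -
  obtain U W and \<Phi> :: "'a \<Rightarrow> 'a" where p: "1 \<le> p" and U: "open U" "xbar \<in> U"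
    and C: "C_on p U \<Phi>" and im: "\<Phi> ` U \<subseteq> W"
    and range: "\<And>x. x \<in> U \<Longrightarrow> range (frechet_derivative \<Phi> (at x)) = W"
    and M: "M \<inter> U = {x \<in> U. \<Phi> x = 0}"
    using assms unfolding manifold_around_def by blast
  define L where "L x = frechet_derivative \<Phi> (at x)" for x
  have "higher_differentiable_on (Suc 0) U \<Phi>"
    using C p by (simp add: C_on_def one_enat_def del: higher_differentiable_on.simps)
  then have deriv: "\<And>x. x \<in> U \<Longrightarrow> (\<Phi> has_derivative L x) (at x)"
    and cont: "\<And>v. continuous_on U (\<lambda>x. L x v)"
    by (simp_all add: L_def frechet_derivative_works)
  have T: "tangent_space M x = {v. L x v = 0}" if "x \<in> M \<inter> U" for x
    by (rule tangent_space_level_set[OF U(1) deriv cont M that])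
      (use im range that in \<open>auto simp: L_def\<close>)
  have lin: "linear (L x)" if "x \<in> U" for x
    using deriv[OF that] by (rule has_derivative_linear)
  show ?thesis
  proof (rule that[OF U])
    show "subspace (tangent_space M x)" if "x \<in> M \<inter> U" for x
      using that lin by (simp add: T linear_subspace_kernel)
    show "continuous_on S (\<lambda>x. orth_proj (tangent_space M x) (b x))"
      if S: "S \<subseteq> M \<inter> U" and b: "continuous_on S b" for S b
    proof -
      have "continuous_on S (\<lambda>x. orth_proj {v. L x v = 0} (b x))"
      proof (rule continuous_on_orth_proj_kernel[OF _ _ _ b])
        fix x assume "x \<in> S"
        then have "x \<in> U" using S by blast
        then show "linear (L x)" "range (L x) = W"
          using lin range[folded L_def] by blast+
      qed (use S in \<open>auto intro: continuous_on_subset[OF cont]\<close>)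
      moreover have "tangent_space M x = {v. L x v = 0}" if "x \<in> S" for x
        using T S that by blast
      ultimately show ?thesis by (simp cong: continuous_on_cong)
    qed
  qed
qed

section \<open>Adding a single-valued operator\<close>

lemma op_sum_single_valued:
  fixes A :: "'a \<Rightarrow> 'b::ab_semigroup_add set"
  shows
  "op_sum A (single_valued_op D B) x = (if x \<in> D then (+) (B x) ` A x else {})"
  by (auto simp: op_sum_def single_valued_op_def set_plus_def add.commute[of _ "B x"])

lemma op_dom_op_sum_single_valued:
  fixes A :: "'a \<Rightarrow> 'b::ab_semigroup_add set"
  shows
  "op_dom (op_sum A (single_valued_op D B)) = op_dom A \<inter> D"
  by (auto simp: op_dom_def op_sum_single_valued)

lemma Lin_translation: "Lin ((+) b ` S) = Lin S"
proof (intro set_eqI iffI)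
  fix v assume "v \<in> Lin ((+) b ` S)"
  then obtain x y where "x \<in> S" "y \<in> affine hull S" "v = (b + y) - (b + x)"
    unfolding Lin_def affine_hull_translation by blast
  then show "v \<in> Lin S" by (auto simp: Lin_def)
next
  fix v assume "v \<in> Lin S"
  then obtain x y where xy: "x \<in> S" "y \<in> affine hull S" "v = y - x"
    unfolding Lin_def by blast
  then have "v = (b + y) - (b + x)" by simp
  then show "v \<in> Lin ((+) b ` S)"
    using xy unfolding Lin_def affine_hull_translation by blast
qed

text \<open>Subtracting \<open>B (X k)\<close> moves a sequence from the graph of the sum to the
  graph of \<open>A\<close>. Its base points lie in \<open>op_dom A \<inter> D \<inter> S\<close>,
  so continuity of \<open>B\<close> within that set suffices.\<close>

lemma usc_along_at_op_sum_single_valued: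
  fixes A :: "'a::t2_space \<Rightarrow> 'b::real_normed_vector set"
  assumes "usc_along_at S A x" "x \<in> D" and B: "continuous (at x within op_dom A \<inter> D \<inter> S) B"
  shows "usc_along_at S (op_sum A (single_valued_op D B)) x"
  unfolding usc_along_at_def
proof (intro allI impI, elim conjE)
  fix X u ubar
  assume X: "\<forall>k. X k \<in> S" "X \<longlonglongrightarrow> x" and u: "u \<longlonglongrightarrow> ubar"
    "\<forall>k. u k \<in> op_sum A (single_valued_op D B) (X k)"
  have XD: "X k \<in> D" and uA: "u k - B (X k) \<in> A (X k)" for k
    using u(2)[rule_format, of k] by (auto simp: op_sum_single_valued split: if_splits)
  have "(\<lambda>k. B (X k)) \<longlonglongrightarrow> B x"
    by (rule continuous_within_tendsto_compose'[OF B _ X(2)])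
      (use X(1) XD uA in \<open>auto simp: op_dom_def\<close>)
  then have "(\<lambda>k. u k - B (X k)) \<longlonglongrightarrow> ubar - B x"
    using u(1) by (intro tendsto_diff)
  then have "ubar - B x \<in> A x"
    by (intro assms(1)[unfolded usc_along_at_def, rule_format, of X "\<lambda>k. u k - B (X k)"] conjI)
      (use X uA in auto)
  then show "ubar \<in> op_sum A (single_valued_op D B) x"
    using \<open>x \<in> D\<close> by (force simp: op_sum_single_valued image_iff)
qed

lemma lsc_along_at_op_sum_single_valued:
  fixes A :: "'a::t2_space \<Rightarrow> 'b::real_normed_vector set"
  assumes "lsc_along_at S A x" "x \<in> D" and B: "continuous (at x within op_dom A \<inter> D \<inter> S) B"
  shows "lsc_along_at S (op_sum A (single_valued_op D B)) x"
  unfolding lsc_along_at_def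
proof (intro ballI allI impI, elim conjE)
  fix X ubar
  assume ubar: "ubar \<in> op_sum A (single_valued_op D B) x"
    and X: "\<forall>k. X k \<in> op_dom (op_sum A (single_valued_op D B)) \<inter> S" "X \<longlonglongrightarrow> x"
  have Xk: "X k \<in> op_dom A \<inter> D \<inter> S" for k
    using X(1) by (simp add: op_dom_op_sum_single_valued)
  have BX: "(\<lambda>k. B (X k)) \<longlonglongrightarrow> B x"
    by (rule continuous_within_tendsto_compose'[OF B _ X(2)]) (use Xk in auto)
  obtain a where a: "a \<in> A x" "ubar = B x + a"
    using ubar \<open>x \<in> D\<close> by (auto simp: op_sum_single_valued)
  moreover have "\<forall>k. X k \<in> op_dom A \<inter> S" using Xk by blast
  ultimately obtain v where v: "\<And>k. v k \<in> A (X k)" "v \<longlonglongrightarrow> a"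
    using assms(1) X(2) unfolding lsc_along_at_def by metis
  have "(\<lambda>k. B (X k) + v k) \<longlonglongrightarrow> ubar"
    unfolding a(2) by (intro tendsto_add BX v)
  moreover have "\<forall>k. B (X k) + v k \<in> op_sum A (single_valued_op D B) (X k)"
    using v(1) Xk by (auto simp: op_sum_single_valued)
  ultimately show "\<exists>u. (\<forall>k. u k \<in> op_sum A (single_valued_op D B) (X k)) \<and> u \<longlonglongrightarrow> ubar"
    by (intro exI[of _ "\<lambda>k. B (X k) + v k"] conjI)
qed

text \<open>Sharpness and continuity along \<open>M\<close> are local and rest on continuity of
  \<open>B\<close> on \<open>U\<close>. Upper semi-continuity is demanded on the whole domain of the
  sum, which is \<open>op_dom A \<inter> D\<close>; hence the second continuity hypothesis.\<close>

lemma partly_smooth_op_sum_single_valued: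
  fixes A :: "'a::euclidean_space \<Rightarrow> 'a set"
  assumes A: "partly_smooth p A xbar M"
    and U: "open U" "xbar \<in> U" "U \<subseteq> D" "continuous_on U B"
    and B: "continuous_on (op_dom A \<inter> D) B"
  shows "partly_smooth p (op_sum A (single_valued_op D B)) xbar M"
  unfolding partly_smooth_def
proof (intro conjI)
  let ?S = "op_sum A (single_valued_op D B)"
  have contB: "continuous (at x within T) B" if "x \<in> U" for x T
    using U that by (simp add: continuous_on_eq_continuous_at continuous_at_imp_continuous_at_within)
  show man: "manifold_around p M xbar" using A by (simp add: partly_smooth_def)
  show "usc ?S"
    unfolding usc_def
  proof
    fix x assume "x \<in> op_dom ?S"
    then have x: "x \<in> op_dom A" "x \<in> D" by (auto simp: op_dom_op_sum_single_valued)
    then have "continuous (at x within op_dom A \<inter> D \<inter> UNIV) B"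
      using B by (simp add: continuous_on_eq_continuous_within)
    moreover have "usc_along_at UNIV A x" using A x by (auto simp: partly_smooth_def usc_def)
    ultimately show "usc_along_at UNIV ?S x"
      using usc_along_at_op_sum_single_valued x by metis
  qed
  have inU: "\<forall>\<^sub>F x in nhds xbar. x \<in> U" using U by (simp add: eventually_nhds_in_open)
  have "\<forall>\<^sub>F x in nhds xbar. A x \<noteq> {} \<and> closed (A x) \<and> convex (A x)"
    using A by (simp add: partly_smooth_def)
  then show "\<forall>\<^sub>F x in nhds xbar. ?S x \<noteq> {} \<and> closed (?S x) \<and> convex (?S x)"
    using inU
    by eventually_elim
      (use U in \<open>auto simp: op_sum_single_valued closed_translation convex_translation\<close>)
  show "normal_space M xbar = Lin (?S xbar)"
    using A U by (auto simp: partly_smooth_def op_sum_single_valued Lin_translation)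
  obtain V f where V: "open V" "xbar \<in> V" "continuous_on (M \<inter> V) f"
    "\<And>x. x \<in> M \<inter> V \<Longrightarrow> orth_proj (tangent_space M x) ` A x = {f x}"
    using A unfolding partly_smooth_def by blast
  obtain V' where V': "open V'" "xbar \<in> V'"
    "\<And>x. x \<in> M \<inter> V' \<Longrightarrow> subspace (tangent_space M x)"
    "\<And>S b. S \<subseteq> M \<inter> V' \<Longrightarrow> continuous_on S b \<Longrightarrow>
       continuous_on S (\<lambda>x. orth_proj (tangent_space M x) (b x))"
    by (rule manifold_around_tangent_space[OF man], rule that)
  show "\<exists>V f. open V \<and> xbar \<in> V \<and> continuous_on (M \<inter> V) f \<and>
      (\<forall>x \<in> M \<inter> V. orth_proj (tangent_space M x) ` ?S x = {f x})"
  proof (intro exI conjI ballI)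
    \<comment> \<open>\<open>U\<close> serves the continuity of \<open>B\<close>, \<open>V\<close>
      the sharpness of \<open>A\<close>, and \<open>V'\<close> the additivity and continuity of the
      tangent projections.\<close>
    show "open (U \<inter> V \<inter> V')" "xbar \<in> U \<inter> V \<inter> V'" using U V V' by auto
    have "continuous_on (M \<inter> (U \<inter> V \<inter> V')) (\<lambda>x. orth_proj (tangent_space M x) (B x))"
      by (rule V'(4)) (auto intro: continuous_on_subset[OF U(4)])
    then show "continuous_on (M \<inter> (U \<inter> V \<inter> V'))
        (\<lambda>x. orth_proj (tangent_space M x) (B x) + f x)"
      by (rule continuous_on_add) (rule continuous_on_subset[OF V(3)], auto)
    show "orth_proj (tangent_space M x) ` ?S x = {orth_proj (tangent_space M x) (B x) + f x}"
      if x: "x \<in> M \<inter> (U \<inter> V \<inter> V')" for x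
    proof -
      have "orth_proj (tangent_space M x) ` ?S x =
          (+) (orth_proj (tangent_space M x) (B x)) ` orth_proj (tangent_space M x) ` A x"
      proof -
        have "x \<in> D" "subspace (tangent_space M x)" using x U(3) V'(3) by blast+
        then show ?thesis by (simp add: op_sum_single_valued image_image orth_proj_add)
      qed
      then show ?thesis using V(4)[of x] x by simp
    qed
  qed
  obtain V'' where V'': "open V''" "xbar \<in> V''"
    "\<And>x. x \<in> M \<inter> V'' \<Longrightarrow> lsc_along_at M A x \<and> usc_along_at M A x"
    using A unfolding partly_smooth_def by blast
  show "\<exists>V. open V \<and> xbar \<in> V \<and> (\<forall>x \<in> M \<inter> V. lsc_along_at M ?S x \<and> usc_along_at M ?S x)"
  proof (intro exI conjI ballI)
    show "open (U \<inter> V'')" "xbar \<in> U \<inter> V''" using U V'' by auto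
    fix x assume "x \<in> M \<inter> (U \<inter> V'')"
    then show "lsc_along_at M ?S x" "usc_along_at M ?S x"
      using V''(3) U(3) contB
      by (auto intro!: lsc_along_at_op_sum_single_valued usc_along_at_op_sum_single_valued)
  qed
qed

lemma C_on_imp_continuous_on: "C_on q U B \<Longrightarrow> continuous_on U B"
  unfolding C_on_def by (metis higher_differentiable_on.simps(1) zero_enat_def zero_le)

text \<open>Smoothness of \<open>B\<close> is local while \<open>usc\<close> is global. Restricted
  to \<open>U\<close>, \<open>B\<close> is continuous on its whole domain; if \<open>B\<close> is
  kept everywhere, continuity on \<open>op_dom A\<close> takes over that role.\<close>

theorem corollary1:
  fixes A :: "'a::euclidean_space \<Rightarrow> 'a set" and B :: "'a \<Rightarrow> 'a"
    and xbar :: 'a and M U :: "'a set" and p q :: enat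
  assumes "partly_smooth p A xbar M"
    and "open U" and "xbar \<in> U" and "1 \<le> q" and "C_on q U B"
  shows "partly_smooth p (op_sum A (single_valued_op U B)) xbar M \<and>
    (continuous_on (op_dom A) B \<longrightarrow>
       partly_smooth p (op_sum A (single_valued_op UNIV B)) xbar M)"
proof -
  have "continuous_on U B" using assms(5) by (rule C_on_imp_continuous_on)
  note sum = partly_smooth_op_sum_single_valued[OF assms(1-3) _ this]
  show ?thesis
  proof (intro conjI impI)
    show "partly_smooth p (op_sum A (single_valued_op U B)) xbar M"
      by (rule sum) (auto intro: continuous_on_subset[OF \<open>continuous_on U B\<close>])
    show "partly_smooth p (op_sum A (single_valued_op UNIV B)) xbar M"
      if "continuous_on (op_dom A) B"
      by (rule sum) (use that in auto)
  qed
qed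

end
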